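(* Assume that $H$ is convex (i.e. each $h_i$ is convex). Let $\{x^k\}$ be the sequence generated by the parameter-dependent generalized conditional gradient algorithm (PGM-CondG) described in the context. Assume that there exists $x^*\in\mathrm{dom}(G)$ such that $F(x^* )\preceq F(x^k)$ for all $k$, and put $\delta_k(x^* )=\min_{1\le i\le m}\{f_i(x^k)-f_i(x^* )\}$. Let $$c=\frac{\nu}{1+\nu},\quad \alpha=\frac1\nu,\quad A=M_\nu^{\frac1\nu}D^{\frac{1+\nu}{\nu}},\quad k_0=\left\lceil\frac1c\left(\log\frac{\delta_0(x^* )}{cA^{1/\alpha}}\right)_+\right\rceil,$$ $$\varGamma_k=\left(\frac{1}{(\delta_{k_0}(x^* ))^{-\alpha}+A^{-1}c\,\alpha\,(k-k_0)}\right)^{\frac1\alpha}.$$ Then $\delta_k(x^* )\le\varGamma_k$ for all $k\ge k_0$. Furthermore, $$\min_{0\le j\le k}|\theta(x^j)|\le \exp(1/\exp(1))\;\varGamma_{\lfloor (k+k_0+1)/2\rfloor}$$ for all $k\ge k_0+\dfrac{2A}{c\,(\delta_{k_0}(x^* ))^{\alpha}}$.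
   Context: Let $m,n\ge 1$. For each $i\in\{1,\dots,m\}$ let $g_i:\mathbb{R}^n\to\mathbb{R}\cup\{+\infty\}$ be proper, convex and lower semicontinuous, let $h_i:\mathbb{R}^n\to\mathbb{R}$ be continuously differentiable, and set $f_i=g_i+h_i$, $F=(f_1,\dots,f_m)^\top$, $G=(g_1,\dots,g_m)^\top$, $H=(h_1,\dots,h_m)^\top$. Put $\mathrm{dom}(g_i)=\{x: g_i(x)<+\infty\}$ and $\mathrm{dom}(G)=\bigcap_i\mathrm{dom}(g_i)$; $\mathrm{dom}(G)$ is assumed nonempty, convex and compact, with diameter $D=\sup_{x,y\in\mathrm{dom}(G)}\|x-y\|$ ($\|\cdot\|$ the Euclidean norm). Hölder assumption: there are $\nu\in(0,1]$ and $M_{i,\nu}>0$ with $\|\nabla h_i(x)-\nabla h_i(y)\|\le M_{i,\nu}\|x-y\|^\nu$ for all $x,y\in\mathrm{dom}(g_i)$, $i=1,\dots,m$; set $M_\nu=\max_i M_{i,\nu}$. For $u,v\in\mathbb{R}^m$, $u\preceq v$ means $u_i\le v_i$ for all $i$. For real $\varrho$, $\varrho_+=\max\{\varrho,0\}$; $\log$ is the natural logarithm. For $x\in\mathrm{dom}(G)$ the gap function is $\theta(x)=\min_{u\in\mathbb{R}^n}\max_{1\le i\le m}\{g_i(u)-g_i(x)+\langle\nabla h_i(x),u-x\rangle\}$ (so $\theta(x)\le0$), and $s(x)\in\mathrm{dom}(G)$ denotes a chosen minimizer. Algorithm PGM-CondG: start from $x^0\in\mathrm{dom}(G)$. At iteration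 $k=0,1,\dots$ compute $s(x^k)$ and $\theta(x^k)$; stop if $\theta(x^k)=0$; otherwise set $$t_k=\min\left\{1,\left(\frac{|\theta(x^k)|}{M_\nu\|s(x^k)-x^k\|^{1+\nu}}\right)^{1/\nu}\right\},\qquad x^{k+1}=x^k+t_k(s(x^k)-x^k).$$ The generated sequence is understood to be infinite, i.e. $\theta(x^k)\ne0$ for all $k$ (then $s(x^k)\neq x^k$). *)

theory Defs
  imports "HOL-Analysis.Analysis"
begin

text \<open>
  Functions with values in \<open>\<real> \<union> {+\<infinity>}\<close> are modelled as \<^typ>\<open>ereal\<close>-valued functions; the value
  \<open>-\<infinity>\<close> is excluded by properness. The index type \<open>'m\<close> plays the role of \<open>{1,\<dots>,m}\<close>, and
  \<open>real ^ 'n\<close> that of \<open>\<real>\<^sup>n\<close>.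
\<close>

definition edom :: "('a \<Rightarrow> ereal) \<Rightarrow> 'a set"
  where "edom g = {x. g x < \<infinity>}"

definition proper_fun :: "('a \<Rightarrow> ereal) \<Rightarrow> bool"
  where "proper_fun g \<longleftrightarrow> (\<forall>x. g x \<noteq> -\<infinity>) \<and> edom g \<noteq> {}"

text \<open>Restricting to \<open>0 < t < 1\<close> avoids the products \<open>0 \<cdot> \<infinity>\<close>.\<close>

definition convex_efun :: "('a::real_vector \<Rightarrow> ereal) \<Rightarrow> bool"
  where "convex_efun g \<longleftrightarrow>
    (\<forall>x y. \<forall>t::real. 0 < t \<and> t < 1 \<longrightarrow>
       g ((1 - t) *\<^sub>R x + t *\<^sub>R y) \<le> ereal (1 - t) * g x + ereal t * g y)"

definition lsc_fun :: "('a::topological_space \<Rightarrow> ereal) \<Rightarrow> bool"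
  where "lsc_fun g \<longleftrightarrow> (\<forall>x. g x \<le> Liminf (at x) g)"

definition gradient :: "('a::real_inner \<Rightarrow> real) \<Rightarrow> 'a \<Rightarrow> 'a"
  where "gradient f x = (THE D. GDERIV f x :> D)"

lemma GDERIV_imp_gradient: "GDERIV f x :> D \<Longrightarrow> gradient f x = D"
proof -
  assume D: "GDERIV f x :> D"
  have "E = D" if "GDERIV f x :> E" for E
  proof -
    have "(\<lambda>h. inner h E) = (\<lambda>h. inner h D)"
      using has_derivative_unique D that unfolding gderiv_def by blast
    then show ?thesis
      by (metis vector_eq_ldot)
  qed
  with D show ?thesis
    unfolding gradient_def by blast
qed

lemma differentiable_imp_GDERIV_gradient:
  fixes f :: "'a::euclidean_space \<Rightarrow> real"
  assumes "f differentiable (at x)"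
  shows "GDERIV f x :> gradient f x"
proof -
  obtain f' where f': "(f has_derivative f') (at x)"
    using assms unfolding differentiable_def by blast
  interpret linear f'
    using f' by (rule has_derivative_linear)
  define D where "D = (\<Sum>b\<in>Basis. f' b *\<^sub>R b)"
  have "f' h = inner h D" for h
  proof -
    have "f' h = f' (\<Sum>b\<in>Basis. inner h b *\<^sub>R b)"
      by (simp add: euclidean_representation)
    also have "\<dots> = (\<Sum>b\<in>Basis. inner h b * f' b)"
      by (simp add: sum scale)
    also have "\<dots> = inner h D"
      unfolding D_def by (simp add: inner_sum_right mult.commute)
    finally show ?thesis .
  qed
  then have "GDERIV f x :> D"
    using f' unfolding gderiv_def by presburger
  then show ?thesis
    using GDERIV_imp_gradient by metis
qed

definition continuously_differentiable :: "('a::real_inner \<Rightarrow> real) \<Rightarrow> bool"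
  where "continuously_differentiable f \<longleftrightarrow>
    (\<forall>x. f differentiable (at x)) \<and> continuous_on UNIV (gradient f)"

definition domG :: "('m \<Rightarrow> 'a \<Rightarrow> ereal) \<Rightarrow> 'a set"
  where "domG g = (\<Inter>i. edom (g i))"

definition objective :: "('m \<Rightarrow> 'a \<Rightarrow> ereal) \<Rightarrow> ('m \<Rightarrow> 'a \<Rightarrow> real) \<Rightarrow> 'm \<Rightarrow> 'a \<Rightarrow> ereal"
  where "objective g h i x = g i x + ereal (h i x)"

definition gap_objective ::
    "('m::finite \<Rightarrow> 'a::real_inner \<Rightarrow> ereal) \<Rightarrow> ('m \<Rightarrow> 'a \<Rightarrow> real) \<Rightarrow> 'a \<Rightarrow> 'a \<Rightarrow> ereal"
  where "gap_objective g h x u =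
    (MAX i. g i u - g i x + ereal (inner (gradient (h i) x) (u - x)))"

text \<open>
  For \<open>x\<close> in \<^term>\<open>domG g\<close> the infimum is attained (by the minimizer \<open>s x\<close> below) and finite, so
  the conversion to \<^typ>\<open>real\<close> loses nothing there. Elsewhere the value is meaningless.
\<close>

definition gap :: "('m::finite \<Rightarrow> 'a::real_inner \<Rightarrow> ereal) \<Rightarrow> ('m \<Rightarrow> 'a \<Rightarrow> real) \<Rightarrow> 'a \<Rightarrow> real"
  where "gap g h x = real_of_ereal (INF u. gap_objective g h x u)"

definition gap_minimizer ::
    "('m::finite \<Rightarrow> 'a::real_inner \<Rightarrow> ereal) \<Rightarrow> ('m \<Rightarrow> 'a \<Rightarrow> real) \<Rightarrow> ('a \<Rightarrow> 'a) \<Rightarrow> bool"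
  where "gap_minimizer g h s \<longleftrightarrow>
    (\<forall>x\<in>domG g. s x \<in> domG g \<and> is_arg_min (gap_objective g h x) (\<lambda>u. True) (s x))"

definition step_size ::
    "('m::finite \<Rightarrow> 'a::real_inner \<Rightarrow> ereal) \<Rightarrow> ('m \<Rightarrow> 'a \<Rightarrow> real) \<Rightarrow> real \<Rightarrow> real \<Rightarrow>
      ('a \<Rightarrow> 'a) \<Rightarrow> 'a \<Rightarrow> real"
  where "step_size g h \<nu> M s x =
    min 1 ((\<bar>gap g h x\<bar> / (M * norm (s x - x) powr (1 + \<nu>))) powr (1 / \<nu>))"

text \<open>Infinite runs only: the stopping test \<open>\<theta>(x\<^sup>k) = 0\<close> never succeeds.\<close>

definition PGM_CondG ::
    "('m::finite \<Rightarrow> 'a::real_inner \<Rightarrow> ereal) \<Rightarrow> ('m \<Rightarrow> 'a \<Rightarrow> real) \<Rightarrow> real \<Rightarrow> real \<Rightarrow>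
      ('a \<Rightarrow> 'a) \<Rightarrow> (nat \<Rightarrow> 'a) \<Rightarrow> bool"
  where "PGM_CondG g h \<nu> M s x \<longleftrightarrow>
    x 0 \<in> domG g \<and>
    (\<forall>k. gap g h (x k) \<noteq> 0 \<and>
         x (Suc k) = x k + step_size g h \<nu> M s (x k) *\<^sub>R (s (x k) - x k))"

text \<open>For \<open>x\<close> and \<open>y\<close> in \<^term>\<open>domG g\<close> all the differences are finite.\<close>

definition merit_gap ::
    "('m::finite \<Rightarrow> 'a \<Rightarrow> ereal) \<Rightarrow> ('m \<Rightarrow> 'a \<Rightarrow> real) \<Rightarrow> 'a \<Rightarrow> 'a \<Rightarrow> real"
  where "merit_gap g h y x = real_of_ereal (MIN i. objective g h i x - objective g h i y)"

end

theory Submission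
  imports Defs
begin

text \<open>
  Write \<open>\<theta>\<^sub>k\<close> for the absolute value of the gap at \<open>x\<^sup>k\<close>. The Hoelder descent lemma together with
  the choice of the step size gives
  \<open>\<delta>\<^sub>k\<^sub>+\<^sub>1 \<le> \<delta>\<^sub>k - c \<theta>\<^sub>k min {1, \<theta>\<^sub>k\<^sup>\<alpha> / A}\<close>, and convexity of \<open>H\<close> gives \<open>\<delta>\<^sub>k \<le> \<theta>\<^sub>k\<close>.
  Hence \<open>\<delta>\<^sub>k\<close> shrinks by the factor \<open>1 - c\<close> as long as \<open>\<delta>\<^sub>k\<^sup>\<alpha> > A\<close>; this lasts at most \<open>k\<^sub>0\<close> steps.
  Afterwards \<open>\<delta>\<^sub>k\<^sub>+\<^sub>1 \<le> \<delta>\<^sub>k (1 - c \<delta>\<^sub>k\<^sup>\<alpha> / A)\<close>, and Bernoulli's inequality makes \<open>\<delta>\<^sub>k\<close> to the power \<open>-\<alpha>\<close>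
  grow by at least \<open>c \<alpha> / A\<close> per step. Summing the descent over the second half of the
  iterations bounds the least gap \<open>\<theta>\<close> by \<open>\<theta>\<^sup>1\<^sup>+\<^sup>\<alpha> \<le> (1 + \<alpha>) \<Gamma>\<^sup>1\<^sup>+\<^sup>\<alpha>\<close>, and the constant comes from
  \<open>a\<^sup>1\<^sup>/\<^sup>a \<le> e\<^sup>1\<^sup>/\<^sup>e\<close>. No \<open>\<delta>\<^sub>k\<close> vanishes in an infinite run, so the powers above are not junk values.
\<close>

section \<open>Rates for an abstract scalar recursion\<close>

text \<open>The maximum is attained at the Euler number e, so the logarithm is compared with its
  tangent there: \<open>ln b \<le> b - 1\<close> at \<open>b = a / exp 1\<close>.\<close>

lemma self_root_le_exp:
  fixes a :: real
  assumes "0 < a"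
  shows "a powr (1 / a) \<le> exp (1 / exp 1)"
proof -
  have "ln a - 1 \<le> a / exp 1 - 1"
    using ln_le_minus_one[of "a / exp 1"] assms by (simp add: ln_div)
  then have "ln a / a \<le> 1 / exp 1"
    using assms by (simp add: field_simps)
  then show ?thesis
    using assms by (simp add: powr_def)
qed

text \<open>All that the rates use of the algorithm. Strict positivity of \<open>\<theta>\<close>
  encodes an infinite run.\<close>

locale cond_grad_recursion =
  fixes \<delta> \<theta> :: "nat \<Rightarrow> real" and A \<alpha> c :: real
  assumes A_pos: "0 < A" and \<alpha>_pos: "0 < \<alpha>" and c_pos: "0 < c" and c_less_1: "c < 1"
    and \<delta>_nonneg: "0 \<le> \<delta> k"
    and \<delta>_le_\<theta>: "\<delta> k \<le> \<theta> k"
    and \<theta>_pos: "0 < \<theta> k"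
    and step: "\<delta> (Suc k) \<le> \<delta> k - c * (\<theta> k * min 1 (\<theta> k powr \<alpha> / A))"
begin

text \<open>The decrease of \<open>\<delta>\<close> guaranteed by one step, up to the factor
  \<open>c\<close>. It is monotone for nonnegative arguments, so \<open>\<theta> k\<close> may be
  replaced by the smaller \<open>\<delta> k\<close>.\<close>

definition decr :: "real \<Rightarrow> real"
  where "decr t = t * min 1 (t powr \<alpha> / A)"

lemma decr_pos: "0 < t \<Longrightarrow> 0 < decr t"
  using A_pos by (simp add: decr_def)

lemma decr_mono: "0 \<le> t \<Longrightarrow> t \<le> u \<Longrightarrow> decr t \<le> decr u"
  unfolding decr_def using A_pos \<alpha>_pos
  by (intro mult_mono min.mono divide_right_mono powr_mono2) auto

lemma step_\<theta>: "\<delta> (Suc k) \<le> \<delta> k - c * decr (\<theta> k)"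
  using step by (simp add: decr_def)

lemma step_\<delta>: "\<delta> (Suc k) \<le> \<delta> k - c * decr (\<delta> k)"
  using step_\<theta>[of k] decr_mono[OF \<delta>_nonneg \<delta>_le_\<theta>, of k] c_pos
  by (smt (verit) mult_left_mono)

text \<open>The next value is nonnegative and strictly smaller.\<close>

lemma \<delta>_pos: "0 < \<delta> k"
  using step_\<theta>[of k] \<delta>_nonneg[of "Suc k"] mult_pos_pos[OF c_pos decr_pos[OF \<theta>_pos[of k]]]
  by linarith

lemma \<delta>_antimono: "antimono \<delta>"
proof (rule decseq_SucI)
  show "\<delta> (Suc k) \<le> \<delta> k" for k
    using step_\<theta>[of k] mult_pos_pos[OF c_pos decr_pos[OF \<theta>_pos[of k]]] by linarith
qed

text \<open>Locates the switch between the two branches of the minimum in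
  \<open>decr\<close>.\<close>

lemma powr_le_A_iff: "0 \<le> t \<Longrightarrow> t powr \<alpha> \<le> A \<longleftrightarrow> t \<le> A powr (1 / \<alpha>)"
proof -
  assume "0 \<le> t"
  have "(A powr (1 / \<alpha>)) powr \<alpha> = A"
    using A_pos \<alpha>_pos by (simp add: powr_powr)
  then show ?thesis
    using \<open>0 \<le> t\<close> \<alpha>_pos powr_mono2[of \<alpha> t "A powr (1 / \<alpha>)"]
      powr_less_mono2[of \<alpha> "A powr (1 / \<alpha>)" t]
    by fastforce
qed

lemma \<delta>_geometric:
  assumes "\<And>j. j < k \<Longrightarrow> A powr (1 / \<alpha>) < \<delta> j"
  shows "\<delta> k \<le> (1 - c) ^ k * \<delta> 0"
  using assms
proof (induction k)
  case (Suc k)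
  have "\<not> \<delta> k powr \<alpha> \<le> A"
    using Suc.prems[of k] powr_le_A_iff[OF \<delta>_nonneg[of k]] by auto
  then have "decr (\<delta> k) = \<delta> k"
    using A_pos by (simp add: decr_def min_def)
  then have "\<delta> (Suc k) \<le> (1 - c) * \<delta> k"
    using step_\<delta>[of k] by (simp add: algebra_simps)
  also have "\<dots> \<le> (1 - c) * ((1 - c) ^ k * \<delta> 0)"
    using Suc c_less_1 by (intro mult_left_mono) auto
  finally show ?case by simp
qed simp

text \<open>If \<open>\<delta> k0\<close> were above the threshold, so would be all earlier values
  by monotonicity. The geometric decay up to \<open>k0\<close> would then push it below the
  threshold after all.\<close>

lemma \<delta>_burn_in:
  assumes "1 / c * max (ln (\<delta> 0 / (c * A powr (1 / \<alpha>)))) 0 \<le> real k0"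
  shows "\<delta> k0 powr \<alpha> \<le> A"
proof (rule ccontr)
  define B where "B = A powr (1 / \<alpha>)"
  have B: "0 < B" using A_pos by (simp add: B_def)
  assume "\<not> \<delta> k0 powr \<alpha> \<le> A"
  then have k0: "B < \<delta> k0"
    using powr_le_A_iff[OF \<delta>_nonneg] by (simp add: B_def)
  have "A powr (1 / \<alpha>) < \<delta> j" if "j < k0" for j
    using antimonoD[OF \<delta>_antimono, of j k0] that k0 by (simp add: B_def)
  then have "\<delta> k0 \<le> (1 - c) ^ k0 * \<delta> 0"
    by (rule \<delta>_geometric)
  also have "\<dots> \<le> exp (- c) ^ k0 * \<delta> 0"
    using c_less_1 exp_ge_add_one_self[of "- c"] \<delta>_nonneg
    by (intro mult_right_mono power_mono) auto
  also have "exp (- c) ^ k0 = exp (- (c * real k0))"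
    by (simp add: exp_of_nat_mult[symmetric] mult.commute)
  also have "\<dots> * \<delta> 0 \<le> exp (- ln (\<delta> 0 / (c * B))) * \<delta> 0"
  proof -
    have "ln (\<delta> 0 / (c * B)) \<le> c * real k0"
      using assms c_pos by (simp add: B_def field_simps)
    then show ?thesis
      using \<delta>_nonneg by (intro mult_right_mono) auto
  qed
  also have "\<dots> = c * B"
    using \<delta>_pos[of 0] c_pos B by (simp add: exp_minus)
  \<comment> \<open>The factor \<open>c\<close> inside the logarithm makes the decay end at
    \<open>c * B\<close>, already below the threshold \<open>B\<close>.\<close>
  also have "\<dots> \<le> B"
    using c_less_1 B by simp
  finally show False
    using k0 by simp
qed

text \<open>The reciprocal of \<Gamma> to the power \<alpha>. The difference is taken in the reals,
  so it is not truncated.\<close>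

definition rate :: "nat \<Rightarrow> nat \<Rightarrow> real"
  where "rate k0 k = \<delta> k0 powr (- \<alpha>) + inverse A * c * \<alpha> * (real k - real k0)"

lemma rate_pos: "k0 \<le> k \<Longrightarrow> 0 < rate k0 k"
  unfolding rate_def using \<delta>_pos[of k0] A_pos c_pos \<alpha>_pos
  by (intro add_pos_nonneg mult_nonneg_nonneg) auto

lemma rate_le_\<delta>_powr:
  assumes "\<delta> k0 powr \<alpha> \<le> A" and "k0 \<le> k"
  shows "rate k0 k \<le> \<delta> k powr (- \<alpha>)"
  using \<open>k0 \<le> k\<close>
proof (induction k rule: dec_induct)
  case base
  then show ?case by (simp add: rate_def)
next
  case (step k)
  \<comment> \<open>The relative decrease in one step; being below the threshold gives
    \<open>y \<le> c < 1\<close>, which keeps \<open>1 - y\<close> positive.\<close>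
  define y where "y = c * \<delta> k powr \<alpha> / A"
  have "\<delta> k powr \<alpha> \<le> \<delta> k0 powr \<alpha>"
    using antimonoD[OF \<delta>_antimono \<open>k0 \<le> k\<close>] \<delta>_nonneg \<alpha>_pos by (intro powr_mono2) auto
  then have le_A: "\<delta> k powr \<alpha> \<le> A"
    using assms(1) by simp
  then have "y \<le> c"
    using c_pos A_pos by (simp add: y_def divide_le_eq mult_left_mono)
  then have y: "0 \<le> y" "y < 1"
    using le_less_trans[OF \<open>y \<le> c\<close> c_less_1] c_pos A_pos by (auto simp: y_def)
  have "decr (\<delta> k) = \<delta> k * (\<delta> k powr \<alpha> / A)"
    using le_A A_pos by (simp add: decr_def min_def)
  then have "\<delta> (Suc k) \<le> \<delta> k * (1 - y)"
    using step_\<delta>[of k] by (simp add: y_def algebra_simps)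
  then have "\<delta> k powr (- \<alpha>) * (1 - y) powr (- \<alpha>) \<le> \<delta> (Suc k) powr (- \<alpha>)"
    using \<delta>_pos[of "Suc k"] \<delta>_pos[of k] y \<alpha>_pos
    by (simp add: powr_mult[symmetric] powr_mono2')
  \<comment> \<open>Bernoulli's inequality for the negative exponent, from
    \<open>ln (1 - y) \<le> - y\<close> and \<open>1 + v \<le> exp v\<close>.\<close>
  moreover have "\<delta> k powr (- \<alpha>) * (1 + \<alpha> * y) \<le> \<delta> k powr (- \<alpha>) * (1 - y) powr (- \<alpha>)"
  proof (rule mult_left_mono)
    have "\<alpha> * y \<le> \<alpha> * - ln (1 - y)"
      using ln_le_minus_one[of "1 - y"] y \<alpha>_pos by (intro mult_left_mono) auto
    then have "1 + \<alpha> * y \<le> exp (- \<alpha> * ln (1 - y))"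
      using exp_ge_add_one_self[of "- \<alpha> * ln (1 - y)"] by simp
    then show "1 + \<alpha> * y \<le> (1 - y) powr (- \<alpha>)"
      using y by (simp add: powr_def)
  qed simp
  \<comment> \<open>The power of \<open>\<delta> k\<close> in \<open>y\<close> cancels, so the
    increment does not depend on \<open>k\<close>.\<close>
  moreover have "\<delta> k powr (- \<alpha>) * (1 + \<alpha> * y) = \<delta> k powr (- \<alpha>) + inverse A * c * \<alpha>"
    using \<delta>_pos[of k] A_pos by (simp add: y_def powr_minus field_simps)
  moreover have "rate k0 (Suc k) = rate k0 k + inverse A * c * \<alpha>"
    by (simp add: rate_def algebra_simps)
  ultimately show ?case
    using step.IH by linarith
qed

lemma \<delta>_le_rate:
  assumes "\<delta> k0 powr \<alpha> \<le> A" and "k0 \<le> k"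
  shows "\<delta> k \<le> (1 / rate k0 k) powr (1 / \<alpha>)"
proof -
  have "1 / \<delta> k powr (- \<alpha>) = \<delta> k powr \<alpha>"
    by (simp add: powr_minus_divide)
  then have "\<delta> k = (1 / \<delta> k powr (- \<alpha>)) powr (1 / \<alpha>)"
    using \<delta>_pos[of k] \<alpha>_pos by (simp add: powr_powr)
  also have "\<dots> \<le> (1 / rate k0 k) powr (1 / \<alpha>)"
    using rate_le_\<delta>_powr[OF assms] rate_pos[OF assms(2)] \<alpha>_pos
    by (intro powr_mono2 divide_left_mono mult_pos_pos) auto
  finally show ?thesis .
qed

text \<open>Telescoping of \<open>step_\<theta>\<close>.\<close>

lemma sum_decr_le:
  "p \<le> k \<Longrightarrow> c * (\<Sum>j=p..k. decr (\<theta> j)) \<le> \<delta> p - \<delta> (Suc k)"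
proof (induction k rule: dec_induct)
  case base
  then show ?case using step_\<theta>[of p] by simp
next
  case (step k)
  then show ?case
    using step_\<theta>[of "Suc k"] by (simp add: algebra_simps)
qed

lemma min_\<theta>_le_rate:
  assumes burn_in: "\<delta> k0 powr \<alpha> \<le> A"
    and k: "real k0 + 2 * A / (c * \<delta> k0 powr \<alpha>) \<le> real k"
  shows "(MIN j\<in>{0..k}. \<theta> j) \<le>
    exp (1 / exp 1) * (1 / rate k0 ((k + k0 + 1) div 2)) powr (1 / \<alpha>)"
proof -
  \<comment> \<open>The midpoint of \<open>k0\<close> and \<open>k\<close>, rounded up. The window
    from \<open>p\<close> to \<open>k\<close> has \<open>N\<close> terms, including both
    ends.\<close>
  define p where "p = (k + k0 + 1) div 2"
  define N where "N = real (Suc k - p)"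
  define m where "m = (MIN j\<in>{0..k}. \<theta> j)"
  define \<Gamma> where "\<Gamma> = (1 / rate k0 p) powr (1 / \<alpha>)"
  have \<delta>0: "0 < \<delta> k0 powr \<alpha>"
    using \<delta>_pos[of k0] by simp
  have "0 < 2 * A / (c * \<delta> k0 powr \<alpha>)"
    using A_pos c_pos \<delta>0 by simp
  then have "k0 < k"
    using k by linarith
  then have p: "k0 \<le> p" "p \<le> k"
    by (auto simp: p_def)
  have m_le: "m \<le> \<theta> j" if "j \<le> k" for j
    using that by (auto simp: m_def)
  have m_pos: "0 < m"
    using \<theta>_pos by (simp add: m_def)
  \<comment> \<open>Rounding up puts \<open>p\<close> at least halfway, and counting both ends still
    leaves the window \<open>N\<close> no shorter than \<open>p - k0\<close>.\<close>
  have q_le_N: "real p - real k0 \<le> N" and N_ge: "(real k - real k0 + 1) / 2 \<le> N"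
    and q_ge: "(real k - real k0) / 2 \<le> real p - real k0"
  proof -
    have "k + k0 \<le> 2 * p" "2 * p \<le> k + k0 + 1"
      by (auto simp: p_def)
    then have "real k + real k0 \<le> 2 * real p" "2 * real p \<le> real k + real k0 + 1"
      by linarith+
    moreover have "N = real k + 1 - real p"
      using p(2) by (simp add: N_def of_nat_diff)
    ultimately show "real p - real k0 \<le> N" "(real k - real k0 + 1) / 2 \<le> N"
      "(real k - real k0) / 2 \<le> real p - real k0"
      by auto
  qed
  have "N * decr m = (\<Sum>j=p..k. decr m)"
    by (simp add: N_def)
  also have "\<dots> \<le> (\<Sum>j=p..k. decr (\<theta> j))"
    using m_le m_pos by (intro sum_mono decr_mono) auto
  finally have "c * (N * decr m) \<le> c * (\<Sum>j=p..k. decr (\<theta> j))"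
    using c_pos by (intro mult_left_mono) auto
  also have "\<dots> \<le> \<delta> p - \<delta> (Suc k)"
    by (rule sum_decr_le[OF p(2)])
  finally have "c * (N * decr m) \<le> \<delta> p - \<delta> (Suc k)" .
  then have descent: "c * N * decr m < \<delta> p"
    using \<delta>_pos[of "Suc k"] by (simp add: mult.assoc)
  have k': "A / (c * \<delta> k0 powr \<alpha>) \<le> (real k - real k0) / 2"
    using k by (simp add: field_simps)
  \<comment> \<open>Otherwise each of the \<open>N\<close> steps loses at least
    \<open>c * m \<ge> c * \<delta> p\<close>, so \<open>c * N < 1\<close>. The lower bound on
    \<open>k\<close> and \<open>burn_in\<close> give \<open>N \<ge> 1 / c\<close> instead.\<close>
  have "m powr \<alpha> \<le> A"
  proof (rule ccontr)
    assume *: "\<not> m powr \<alpha> \<le> A"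
    then have "decr m = m"
      using A_pos by (simp add: decr_def min_def)
    moreover have "\<delta> p \<le> m"
    proof -
      have "\<delta> p \<le> \<delta> k0" using antimonoD[OF \<delta>_antimono p(1)] .
      also have "\<dots> \<le> A powr (1 / \<alpha>)"
        using burn_in powr_le_A_iff[OF \<delta>_nonneg] by blast
      also have "\<dots> \<le> m"
        using * powr_le_A_iff[of m] m_pos by simp
      finally show ?thesis .
    qed
    ultimately have "c * N < 1"
      using descent m_pos by (smt (verit) mult_le_cancel_right1)
    have "1 / c \<le> A / (c * \<delta> k0 powr \<alpha>)"
      using burn_in c_pos \<delta>0 by (simp add: field_simps)
    moreover have "(real k - real k0) / 2 \<le> N"
      using N_ge by (simp add: field_simps)
    ultimately have "1 / c \<le> N"
      using k' by (blast intro: order_trans)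
    then show False
      using \<open>c * N < 1\<close> c_pos by (simp add: field_simps)
  qed
  then have decr_m: "decr m = m powr (1 + \<alpha>) / A"
    using A_pos m_pos by (simp add: decr_def min_def powr_add)
  have rate_p: "0 < rate k0 p"
    using rate_pos[OF p(1)] .
  have \<Gamma>_pos: "0 < \<Gamma>"
    using rate_p by (simp add: \<Gamma>_def)
  have \<Gamma>_powr: "\<Gamma> powr \<alpha> = 1 / rate k0 p"
    using rate_p \<alpha>_pos by (simp add: \<Gamma>_def powr_powr)
  \<comment> \<open>This is where the lower bound on \<open>k\<close> enters again: the initial term
    of \<open>rate\<close> is absorbed into the linear one, at the price of the factor
    \<open>1 + \<alpha>\<close>.\<close>
  have "\<delta> k0 powr (- \<alpha>) \<le> inverse A * c * N"
  proof -
    have "A / (c * \<delta> k0 powr \<alpha>) \<le> N"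
      using k' q_ge q_le_N by linarith
    then show ?thesis
      using A_pos c_pos \<delta>0 by (simp add: powr_minus field_simps)
  qed
  moreover have "inverse A * c * \<alpha> * (real p - real k0) \<le> inverse A * c * \<alpha> * N"
    using q_le_N A_pos c_pos \<alpha>_pos by (intro mult_left_mono) auto
  ultimately have rate_le: "rate k0 p \<le> inverse A * c * N * (1 + \<alpha>)"
    by (simp add: rate_def algebra_simps)
  \<comment> \<open>Two bounds meet: \<open>rate_le\<close> bounds the rate by a multiple of
    \<open>N\<close>, and \<open>descent\<close> bounds \<open>c * N * decr m\<close> by
    \<open>\<delta> p\<close>, hence by \<open>\<Gamma>\<close>. Dividing by the rate multiplies by
    \<Gamma> to the power \<alpha>.\<close>
  have "rate k0 p * m powr (1 + \<alpha>) \<le> inverse A * c * N * (1 + \<alpha>) * m powr (1 + \<alpha>)"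
    using rate_le by (intro mult_right_mono) auto
  also have "\<dots> = (1 + \<alpha>) * (c * N * decr m)"
    by (simp add: decr_m field_simps)
  also have "\<dots> \<le> (1 + \<alpha>) * \<Gamma>"
    using descent \<delta>_le_rate[OF burn_in p(1)] \<alpha>_pos
    by (intro mult_left_mono) (auto simp: \<Gamma>_def)
  finally have "m powr (1 + \<alpha>) \<le> (1 + \<alpha>) * \<Gamma> * (1 / rate k0 p)"
    using rate_p by (simp add: field_simps)
  also have "\<dots> = (1 + \<alpha>) * \<Gamma> powr (1 + \<alpha>)"
    using \<Gamma>_pos \<Gamma>_powr by (simp add: powr_add)
  finally have "(m powr (1 + \<alpha>)) powr (1 / (1 + \<alpha>)) \<le>
      ((1 + \<alpha>) * \<Gamma> powr (1 + \<alpha>)) powr (1 / (1 + \<alpha>))"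
    using \<alpha>_pos by (intro powr_mono2) auto
  then have "m \<le> (1 + \<alpha>) powr (1 / (1 + \<alpha>)) * \<Gamma>"
    using m_pos \<Gamma>_pos \<alpha>_pos by (simp add: powr_mult powr_powr)
  also have "\<dots> \<le> exp (1 / exp 1) * \<Gamma>"
    using self_root_le_exp[of "1 + \<alpha>"] \<alpha>_pos \<Gamma>_pos by (intro mult_right_mono) auto
  finally show ?thesis
    by (simp add: m_def \<Gamma>_def p_def)
qed

end

section \<open>Step size, Hoelder descent and the gradient inequality\<close>

text \<open>The third claim is
  \<open>t powr \<nu> \<le> \<theta> / (M * d powr (1 + \<nu>))\<close>, multiplied out; it will
  control the Taylor remainder. The fourth replaces \<open>d\<close> by \<open>D\<close>, giving a
  lower bound independent of the iterate except through \<open>\<theta>\<close>.\<close>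

lemma clipped_step_bounds:
  fixes \<theta> M d D \<nu> :: real
  assumes "0 < \<theta>" "0 < M" "0 < d" "d \<le> D" "0 < \<nu>"
  defines "t \<equiv> min 1 ((\<theta> / (M * d powr (1 + \<nu>))) powr (1 / \<nu>))"
  shows "0 < t" and "t \<le> 1"
    and "M * t powr (1 + \<nu>) * d powr (1 + \<nu>) \<le> t * \<theta>"
    and "min 1 (\<theta> powr (1 / \<nu>) / (M powr (1 / \<nu>) * D powr ((1 + \<nu>) / \<nu>))) \<le> t"
proof -
  define r where "r = \<theta> / (M * d powr (1 + \<nu>))"
  have r: "0 < r" using assms by (simp add: r_def)
  have t: "t = min 1 (r powr (1 / \<nu>))" by (simp add: t_def r_def)
  show "0 < t" "t \<le> 1" using r by (auto simp: t)
  have "t \<le> r powr (1 / \<nu>)"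
    by (simp add: t)
  then have "t powr \<nu> \<le> (r powr (1 / \<nu>)) powr \<nu>"
    using \<open>0 < t\<close> \<open>0 < \<nu>\<close> by (intro powr_mono2) auto
  then have "t powr \<nu> \<le> r"
    using r assms by (simp add: powr_powr)
  then have "M * d powr (1 + \<nu>) * t powr \<nu> \<le> \<theta>"
    using assms by (simp add: r_def field_simps)
  then have "t * (M * d powr (1 + \<nu>) * t powr \<nu>) \<le> t * \<theta>"
    using \<open>0 < t\<close> by (intro mult_left_mono) auto
  then show "M * t powr (1 + \<nu>) * d powr (1 + \<nu>) \<le> t * \<theta>"
    using \<open>0 < t\<close> by (simp add: powr_add mult_ac)
  have "d powr ((1 + \<nu>) / \<nu>) \<le> D powr ((1 + \<nu>) / \<nu>)"
    using assms by (intro powr_mono2) auto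
  then have "\<theta> powr (1 / \<nu>) / (M powr (1 / \<nu>) * D powr ((1 + \<nu>) / \<nu>)) \<le>
      \<theta> powr (1 / \<nu>) / (M powr (1 / \<nu>) * d powr ((1 + \<nu>) / \<nu>))"
    using assms by (intro divide_left_mono mult_left_mono mult_pos_pos) auto
  also have "\<dots> = r powr (1 / \<nu>)"
    using assms by (simp add: r_def powr_divide powr_mult powr_powr)
  finally show "min 1 (\<theta> powr (1 / \<nu>) / (M powr (1 / \<nu>) * D powr ((1 + \<nu>) / \<nu>))) \<le> t"
    by (auto simp: t)
qed

lemma DERIV_along_line:
  fixes h :: "'a::euclidean_space \<Rightarrow> real"
  assumes "continuously_differentiable h"
  shows "((\<lambda>t. h (y + t *\<^sub>R d)) has_real_derivative inner (gradient h (y + t *\<^sub>R d)) d) (at t)"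
proof -
  have "(h has_derivative (\<lambda>v. inner v (gradient h (y + t *\<^sub>R d)))) (at (y + t *\<^sub>R d))"
    using assms differentiable_imp_GDERIV_gradient
    unfolding continuously_differentiable_def gderiv_def by blast
  moreover have "((\<lambda>t. y + t *\<^sub>R d) has_derivative (\<lambda>u. u *\<^sub>R d)) (at t)"
    by (auto intro!: derivative_eq_intros)
  ultimately have "((\<lambda>t. h (y + t *\<^sub>R d)) has_derivative
      (\<lambda>u. inner (u *\<^sub>R d) (gradient h (y + t *\<^sub>R d)))) (at t)"
    by (rule has_derivative_compose[rotated])
  moreover have "(\<lambda>u. inner (u *\<^sub>R d) (gradient h (y + t *\<^sub>R d))) =
      (*) (inner (gradient h (y + t *\<^sub>R d)) d)"
    by (rule ext) (simp add: inner_commute)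
  ultimately show ?thesis
    by (simp add: has_field_derivative_def)
qed

text \<open>The function \<open>\<phi>\<close>, which is \<open>h\<close> along the segment minus
  the linear and Hoelder terms, has nonpositive derivative by Cauchy-Schwarz and the Hoelder bound.
  This replaces integrating the gradient.\<close>

lemma hoelder_descent:
  fixes h :: "'a::euclidean_space \<Rightarrow> real"
  assumes h: "continuously_differentiable h"
    and S: "convex S" "y \<in> S" "y + d \<in> S"
    and hoelder: "\<And>z. z \<in> S \<Longrightarrow> norm (gradient h z - gradient h y) \<le> M * norm (z - y) powr \<nu>"
    and \<nu>: "0 < \<nu>" and t: "0 \<le> t" "t \<le> 1"
  shows "h (y + t *\<^sub>R d) \<le>
    h y + t * inner (gradient h y) d + M / (1 + \<nu>) * t powr (1 + \<nu>) * norm d powr (1 + \<nu>)"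
proof -
  define \<phi> where "\<phi> u = h (y + u *\<^sub>R d) - u * inner (gradient h y) d
    - M / (1 + \<nu>) * norm d powr (1 + \<nu>) * u powr (1 + \<nu>)" for u
  have line: "((\<lambda>u. h (y + u *\<^sub>R d)) has_real_derivative inner (gradient h (y + u *\<^sub>R d)) d) (at u)"
    for u by (rule DERIV_along_line[OF h])
  have "\<phi> t \<le> \<phi> 0"
  \<comment> \<open>The derivative rule for \<open>powr\<close> asks for \<open>u > 0\<close>, so
    the endpoint 0 is covered by continuity only.\<close>
  proof (rule DERIV_nonpos_imp_decreasing_open[OF t(1)])
    fix u assume u: "0 < u" "u < t"
    have "(\<phi> has_real_derivative inner (gradient h (y + u *\<^sub>R d)) d - inner (gradient h y) d
        - M * norm d powr (1 + \<nu>) * u powr \<nu>) (at u)"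
    proof -
      have "((\<lambda>u. M / (1 + \<nu>) * norm d powr (1 + \<nu>) * u powr (1 + \<nu>)) has_real_derivative
          M / (1 + \<nu>) * norm d powr (1 + \<nu>) * ((1 + \<nu>) * u powr \<nu>)) (at u)"
        using has_real_derivative_powr[of u "1 + \<nu>"] u by (intro DERIV_cmult) simp
      also have "M / (1 + \<nu>) * norm d powr (1 + \<nu>) * ((1 + \<nu>) * u powr \<nu>)
          = M * norm d powr (1 + \<nu>) * u powr \<nu>"
        using \<nu> by simp
      finally have powr: "((\<lambda>u. M / (1 + \<nu>) * norm d powr (1 + \<nu>) * u powr (1 + \<nu>))
          has_real_derivative M * norm d powr (1 + \<nu>) * u powr \<nu>) (at u)" .
      have linear: "((\<lambda>u. u * inner (gradient h y) d) has_real_derivative inner (gradient h y) d)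
          (at u)"
        by (auto intro!: derivative_eq_intros)
      show ?thesis
        unfolding \<phi>_def by (rule DERIV_diff[OF DERIV_diff[OF line linear] powr])
    qed
    moreover have "inner (gradient h (y + u *\<^sub>R d)) d - inner (gradient h y) d
        \<le> M * norm d powr (1 + \<nu>) * u powr \<nu>"
    proof -
      \<comment> \<open>The Hoelder bound is available only inside \<open>S\<close>; convexity keeps
        the segment there.\<close>
      have "(1 - u) *\<^sub>R y + u *\<^sub>R (y + d) \<in> S"
        using S u t by (intro convexD_alt) auto
      then have "y + u *\<^sub>R d \<in> S"
        by (simp add: algebra_simps)
      have "inner (gradient h (y + u *\<^sub>R d) - gradient h y) d
          \<le> norm (gradient h (y + u *\<^sub>R d) - gradient h y) * norm d"
        by (rule norm_cauchy_schwarz)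
      also have "\<dots> \<le> M * norm (u *\<^sub>R d) powr \<nu> * norm d"
        using hoelder[OF \<open>y + u *\<^sub>R d \<in> S\<close>] by (intro mult_right_mono) auto
      also have "\<dots> = M * norm d powr (1 + \<nu>) * u powr \<nu>"
        using u by (simp add: powr_mult powr_add)
      finally show ?thesis
        by (simp add: inner_diff_left)
    qed
    ultimately show "\<exists>y. DERIV \<phi> u :> y \<and> y \<le> 0"
      by (metis diff_le_0_iff_le)
  next
    have "continuous_on {0..t} (\<lambda>u. h (y + u *\<^sub>R d))"
      by (intro continuous_at_imp_continuous_on ballI DERIV_isCont[OF line])
    moreover have "continuous_on {0..t} (\<lambda>u. u powr (1 + \<nu>))"
      using \<nu> by (intro continuous_on_powr' continuous_on_id continuous_on_const) auto
    ultimately show "continuous_on {0..t} \<phi>"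
      unfolding \<phi>_def
      by (intro continuous_on_diff continuous_on_mult continuous_on_id continuous_on_const)
  qed
  then show ?thesis
    using \<nu> by (simp add: \<phi>_def mult_ac)
qed

text \<open>Restriction to the line through \<open>y\<close> and \<open>z\<close> reduces this to
  the tangent inequality of a real function at 0, evaluated at 1.\<close>

lemma convex_above_gradient:
  fixes h :: "'a::euclidean_space \<Rightarrow> real"
  assumes "continuously_differentiable h" and conv: "convex_on UNIV h"
  shows "h y + inner (gradient h y) (z - y) \<le> h z"
proof -
  have "convex_on UNIV (\<lambda>t. h (y + t *\<^sub>R (z - y)))"
  proof (rule convex_onI)
    fix t u v :: real assume "0 < t" "t < 1"
    have "y + ((1 - t) *\<^sub>R u + t *\<^sub>R v) *\<^sub>R (z - y)
        = (1 - t) *\<^sub>R (y + u *\<^sub>R (z - y)) + t *\<^sub>R (y + v *\<^sub>R (z - y))"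
      by (simp add: algebra_simps)
    then show "h (y + ((1 - t) *\<^sub>R u + t *\<^sub>R v) *\<^sub>R (z - y))
        \<le> (1 - t) * h (y + u *\<^sub>R (z - y)) + t * h (y + v *\<^sub>R (z - y))"
      using convex_onD[OF conv, of t] \<open>0 < t\<close> \<open>t < 1\<close> by simp
  qed auto
  from convex_on_imp_above_tangent[OF this, of 0 1 "inner (gradient h y) (z - y)"]
    DERIV_along_line[OF assms(1), of y "z - y" 0]
  show ?thesis by simp
qed

section \<open>From extended real to real values\<close>

lemma ereal_Max_range: "ereal (MAX i. f i) = (MAX i. ereal (f i))" for f :: "'m::finite \<Rightarrow> real"
  using mono_Max_commute[of ereal "range f"] by (simp add: mono_def image_comp comp_def)

lemma ereal_Min_range: "ereal (MIN i. f i) = (MIN i. ereal (f i))" for f :: "'m::finite \<Rightarrow> real"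
  using mono_Min_commute[of ereal "range f"] by (simp add: mono_def image_comp comp_def)

lemma domG_ereal:
  assumes "\<And>i. proper_fun (g i)" and "y \<in> domG g"
  shows "g i y = ereal (real_of_ereal (g i y))"
proof -
  have "g i y \<noteq> \<infinity>" "g i y \<noteq> - \<infinity>"
    using assms by (auto simp: domG_def edom_def proper_fun_def)
  then show ?thesis
    by (cases "g i y") auto
qed

text \<open>Real form of the terms in \<open>gap_objective\<close>; for proper \<open>g i\<close>
  and both points in \<open>domG g\<close> the conversion loses nothing.\<close>

definition gap_summand ::
    "('m \<Rightarrow> 'a::real_inner \<Rightarrow> ereal) \<Rightarrow> ('m \<Rightarrow> 'a \<Rightarrow> real) \<Rightarrow> 'a \<Rightarrow> 'a \<Rightarrow> 'm \<Rightarrow> real"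
  where "gap_summand g h y u i =
    real_of_ereal (g i u) - real_of_ereal (g i y) + inner (gradient (h i) y) (u - y)"

lemma gap_objective_eq_Max:
  fixes g :: "'m::finite \<Rightarrow> 'a::real_inner \<Rightarrow> ereal"
  assumes "\<And>i. proper_fun (g i)" and "y \<in> domG g" and "u \<in> domG g"
  shows "gap_objective g h y u = ereal (MAX i. gap_summand g h y u i)"
proof -
  have "g i u - g i y + ereal (inner (gradient (h i) y) (u - y)) = ereal (gap_summand g h y u i)"
    for i
    by (subst domG_ereal[OF assms(1,2)], subst domG_ereal[OF assms(1,3)])
      (simp add: gap_summand_def)
  then show ?thesis
    by (simp add: gap_objective_def ereal_Max_range)
qed

text \<open>The infimum over the whole space is attained at \<open>s y\<close>, which lies in
  \<open>domG g\<close>, so it is finite. The second claim is for testing the gap with points such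
  as the reference point \<open>xs\<close>.\<close>

lemma gap_eq_Max:
  fixes g :: "'m::finite \<Rightarrow> 'a::real_inner \<Rightarrow> ereal"
  assumes "\<And>i. proper_fun (g i)" and "gap_minimizer g h s" and "y \<in> domG g"
  shows "gap g h y = (MAX i. gap_summand g h y (s y) i)"
    and "u \<in> domG g \<Longrightarrow> gap g h y \<le> (MAX i. gap_summand g h y u i)"
proof -
  have s: "s y \<in> domG g" and le: "gap_objective g h y (s y) \<le> gap_objective g h y u" for u
    using assms(2,3) by (auto simp: gap_minimizer_def is_arg_min_def not_less)
  have "(INF u. gap_objective g h y u) = gap_objective g h y (s y)"
    using le by (intro antisym INF_lower INF_greatest) auto
  then show eq: "gap g h y = (MAX i. gap_summand g h y (s y) i)"
    by (simp add: gap_def gap_objective_eq_Max[OF assms(1,3) s])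
  show "gap g h y \<le> (MAX i. gap_summand g h y u i)" if "u \<in> domG g"
    using le[of u] by (simp add: eq gap_objective_eq_Max[OF assms(1,3)] s that)
qed

text \<open>The real value of \<open>objective g h i\<close> on \<open>domG g\<close>.\<close>

definition merit ::
    "('m \<Rightarrow> 'a \<Rightarrow> ereal) \<Rightarrow> ('m \<Rightarrow> 'a \<Rightarrow> real) \<Rightarrow> 'm \<Rightarrow> 'a \<Rightarrow> real"
  where "merit g h i y = real_of_ereal (g i y) + h i y"

lemma objective_eq_merit:
  assumes "\<And>i. proper_fun (g i)" and "y \<in> domG g"
  shows "objective g h i y = ereal (merit g h i y)"
  unfolding objective_def merit_def by (subst domG_ereal[OF assms]) simp

lemma merit_gap_eq_Min:
  fixes g :: "'m::finite \<Rightarrow> 'a \<Rightarrow> ereal"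
  assumes "\<And>i. proper_fun (g i)" and "y \<in> domG g" and "z \<in> domG g"
  shows "merit_gap g h y z = (MIN i. merit g h i z - merit g h i y)"
  by (simp add: merit_gap_def objective_eq_merit[OF assms(1,2)] objective_eq_merit[OF assms(1,3)]
      ereal_Min_range[symmetric])

section \<open>Decrease of each objective along a step\<close>

lemma convex_efun_domG:
  assumes "\<And>i. proper_fun (g i)" and "\<And>i. convex_efun (g i)"
    and "convex (domG g)" and "y \<in> domG g" and "z \<in> domG g" and "0 < t" and "t \<le> 1"
  shows "y + t *\<^sub>R (z - y) \<in> domG g"
    and "real_of_ereal (g i (y + t *\<^sub>R (z - y))) \<le>
      real_of_ereal (g i y) + t * (real_of_ereal (g i z) - real_of_ereal (g i y))"
proof -
  have w: "y + t *\<^sub>R (z - y) = (1 - t) *\<^sub>R y + t *\<^sub>R z"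
    by (simp add: algebra_simps)
  show dom: "y + t *\<^sub>R (z - y) \<in> domG g"
    unfolding w using assms by (intro convexD_alt) auto
  show "real_of_ereal (g i (y + t *\<^sub>R (z - y))) \<le>
      real_of_ereal (g i y) + t * (real_of_ereal (g i z) - real_of_ereal (g i y))"
  \<comment> \<open>A full step is separate because \<open>convex_efun\<close> speaks of
    \<open>0 < t < 1\<close> only.\<close>
  proof (cases "t = 1")
    case False
    then have "g i (y + t *\<^sub>R (z - y)) \<le> ereal (1 - t) * g i y + ereal t * g i z"
      unfolding w using assms(2)[of i] \<open>0 < t\<close> \<open>t \<le> 1\<close> unfolding convex_efun_def by simp
    moreover obtain a b e where "g i y = ereal a" "g i z = ereal b"
      "g i (y + t *\<^sub>R (z - y)) = ereal e"
      using domG_ereal[OF assms(1,4)] domG_ereal[OF assms(1,5)] domG_ereal[OF assms(1) dom]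
      by blast
    ultimately show ?thesis
      by (simp add: algebra_simps)
  qed simp
qed

text \<open>The Taylor remainder is at most \<open>t \<theta> / (1 + \<nu>)\<close>, which costs the fraction \<open>1 / (1 + \<nu>)\<close>
  of the linear decrease \<open>t \<theta>\<close>.\<close>

lemma merit_descent:
  fixes g :: "'m \<Rightarrow> 'a::euclidean_space \<Rightarrow> ereal"
  assumes "\<And>i. proper_fun (g i)" and "\<And>i. convex_efun (g i)"
    and h: "continuously_differentiable (h i)"
    and dom: "convex (domG g)" and y: "y \<in> domG g" and z: "z \<in> domG g"
    and hoelder: "\<And>u. u \<in> domG g \<Longrightarrow>
      norm (gradient (h i) u - gradient (h i) y) \<le> M * norm (u - y) powr \<nu>"
    and \<nu>: "0 < \<nu>" and t: "0 < t" "t \<le> 1"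
    and summand: "gap_summand g h y z i \<le> - \<theta>"
    and short: "M * t powr (1 + \<nu>) * norm (z - y) powr (1 + \<nu>) \<le> t * \<theta>"
  shows "merit g h i (y + t *\<^sub>R (z - y)) \<le> merit g h i y - \<nu> / (1 + \<nu>) * (t * \<theta>)"
proof -
  have "h i (y + t *\<^sub>R (z - y)) \<le> h i y + t * inner (gradient (h i) y) (z - y)
      + M / (1 + \<nu>) * t powr (1 + \<nu>) * norm (z - y) powr (1 + \<nu>)"
    using h dom y z hoelder \<nu> t by (intro hoelder_descent[where S = "domG g"]) auto
  moreover have "M / (1 + \<nu>) * t powr (1 + \<nu>) * norm (z - y) powr (1 + \<nu>) \<le> t * \<theta> / (1 + \<nu>)"
    using divide_right_mono[OF short, of "1 + \<nu>"] \<nu> by simp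
  moreover have "t * gap_summand g h y z i \<le> - (t * \<theta>)"
    using mult_left_mono[OF summand, of t] t by simp
  moreover have "t * \<theta> / (1 + \<nu>) - t * \<theta> = - (\<nu> / (1 + \<nu>) * (t * \<theta>))"
    using \<nu> by (simp add: field_simps)
  ultimately show ?thesis
    using convex_efun_domG(2)[OF assms(1,2) dom y z t, of i]
    by (simp add: merit_def gap_summand_def algebra_simps)
qed

section \<open>The algorithm as an instance of the recursion\<close>

theorem theorem3p5:
  fixes g :: "'m::finite \<Rightarrow> real ^ 'n \<Rightarrow> ereal"
    and h :: "'m \<Rightarrow> real ^ 'n \<Rightarrow> real"
    and Mi :: "'m \<Rightarrow> real"
    and \<nu> M D c \<alpha> A :: real
    and s :: "real ^ 'n \<Rightarrow> real ^ 'n"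
    and x :: "nat \<Rightarrow> real ^ 'n"
    and xs :: "real ^ 'n"
    and \<delta> \<Gamma> :: "nat \<Rightarrow> real"
    and k0 :: nat
  assumes g_proper: "\<And>i. proper_fun (g i)"
    and g_convex: "\<And>i. convex_efun (g i)"
    and g_lsc: "\<And>i. lsc_fun (g i)"
    and h_C1: "\<And>i. continuously_differentiable (h i)"
    and dom_nonempty: "domG g \<noteq> {}"
    and dom_convex: "convex (domG g)"
    and dom_compact: "compact (domG g)"
    and D_eq: "D = diameter (domG g)"
    and nu_range: "0 < \<nu>" "\<nu> \<le> 1"
    and Mi_pos: "\<And>i. 0 < Mi i"
    and hoelder: "\<And>i y z. y \<in> edom (g i) \<Longrightarrow> z \<in> edom (g i) \<Longrightarrow>
        norm (gradient (h i) y - gradient (h i) z) \<le> Mi i * norm (y - z) powr \<nu>"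
    and M_eq: "M = (MAX i. Mi i)"
    and h_convex: "\<And>i. convex_on UNIV (h i)"
    and s_min: "gap_minimizer g h s"
    and alg: "PGM_CondG g h \<nu> M s x"
    and xs_dom: "xs \<in> domG g"
    and xs_le: "\<And>k i. objective g h i xs \<le> objective g h i (x k)"
    and delta_eq: "\<And>k. \<delta> k = merit_gap g h xs (x k)"
    and c_eq: "c = \<nu> / (1 + \<nu>)"
    and alpha_eq: "\<alpha> = 1 / \<nu>"
    and A_eq: "A = M powr (1 / \<nu>) * D powr ((1 + \<nu>) / \<nu>)"
    and k0_eq: "k0 = nat \<lceil>1 / c * max (ln (\<delta> 0 / (c * A powr (1 / \<alpha>)))) 0\<rceil>"
    and Gamma_eq: "\<And>k. \<Gamma> k =
        (1 / (\<delta> k0 powr (- \<alpha>) + inverse A * c * \<alpha> * (real k - real k0))) powr (1 / \<alpha>)"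
  shows "(\<forall>k\<ge>k0. \<delta> k \<le> \<Gamma> k) \<and>
    (\<forall>k. real k \<ge> real k0 + 2 * A / (c * \<delta> k0 powr \<alpha>) \<longrightarrow>
       (MIN j\<in>{0..k}. \<bar>gap g h (x j)\<bar>) \<le> exp (1 / exp 1) * \<Gamma> ((k + k0 + 1) div 2))"
proof -
  define \<theta> where "\<theta> k = \<bar>gap g h (x k)\<bar>" for k
  define t where "t k = step_size g h \<nu> M s (x k)" for k
  have Mi_le: "Mi i \<le> M" for i
    by (simp add: M_eq)
  have M_pos: "0 < M"
    using Mi_pos Mi_le less_le_trans by blast
  \<comment> \<open>Testing with \<open>u = y\<close> makes every summand 0.\<close>
  have gap_self: "gap g h y \<le> 0" if "y \<in> domG g" for y
    using gap_eq_Max(2)[OF g_proper s_min that that]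
    by (simp add: gap_summand_def)
  have s_dom: "s y \<in> domG g" if "y \<in> domG g" for y
    using s_min that by (simp add: gap_minimizer_def)
  have \<theta>_pos: "0 < \<theta> k" for k
    using alg by (simp add: \<theta>_def PGM_CondG_def)
  have x_Suc: "x (Suc k) = x k + t k *\<^sub>R (s (x k) - x k)" for k
    using alg by (simp add: PGM_CondG_def t_def)

  \<comment> \<open>A fixed point of \<open>s\<close> would have gap 0 and end the run. Hence the
    step size never divides by 0.\<close>
  have moves: "s (x k) \<noteq> x k" if "x k \<in> domG g" for k
  proof
    assume "s (x k) = x k"
    then have "gap g h (x k) = 0"
      using gap_eq_Max(1)[OF g_proper s_min that] by (simp add: gap_summand_def)
    then show False
      using \<theta>_pos[of k] by (simp add: \<theta>_def)
  qed
  have dist_le_D: "norm (s (x k) - x k) \<le> D" if "x k \<in> domG g" for k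
    using diameter_bounded_bound[OF compact_imp_bounded[OF dom_compact] s_dom that] that
    by (simp add: D_eq dist_norm)
  have t_eq: "t k = min 1 ((\<theta> k / (M * norm (s (x k) - x k) powr (1 + \<nu>))) powr (1 / \<nu>))" for k
    by (simp add: t_def step_size_def \<theta>_def)
  have clipped: "0 < t k" "t k \<le> 1"
      "M * t k powr (1 + \<nu>) * norm (s (x k) - x k) powr (1 + \<nu>) \<le> t k * \<theta> k"
      "min 1 (\<theta> k powr \<alpha> / A) \<le> t k" if "x k \<in> domG g" for k
    using clipped_step_bounds[OF \<theta>_pos M_pos _ dist_le_D[OF that] nu_range(1), of k] moves[OF that]
    by (simp_all add: t_eq[symmetric] A_eq alpha_eq)
  \<comment> \<open>The facts above assume \<open>x k \<in> domG g\<close> since this induction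
    needs them: membership gives a step in (0, 1], and convexity then gives the next
    membership.\<close>
  have x_dom: "x k \<in> domG g" for k
  proof (induction k)
    case 0
    then show ?case using alg by (simp add: PGM_CondG_def)
  next
    case (Suc k)
    then show ?case
      using convex_efun_domG(1)[OF g_proper g_convex dom_convex Suc.IH s_dom clipped(1,2)]
      by (simp add: x_Suc)
  qed
  have gap_eq: "gap g h (x k) = - \<theta> k" for k
    using gap_self[OF x_dom[of k]] by (simp add: \<theta>_def)

  have hoelder_M: "norm (gradient (h i) u - gradient (h i) y) \<le> M * norm (u - y) powr \<nu>"
    if "u \<in> domG g" "y \<in> domG g" for i u y
  proof -
    have "u \<in> edom (g i)" "y \<in> edom (g i)"
      using that by (auto simp: domG_def)
    then show ?thesis
      using hoelder[of u i y] mult_right_mono[OF Mi_le[of i], of "norm (u - y) powr \<nu>"] by force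
  qed
  \<comment> \<open>The decrease is the same for all \<open>i\<close>, because every summand is at
    most the gap; so it passes to the minimum \<open>\<delta>\<close>.\<close>
  have descent: "merit g h i (x (Suc k)) \<le> merit g h i (x k) - c * (t k * \<theta> k)" for i k
    unfolding x_Suc c_eq
  proof (rule merit_descent[OF g_proper g_convex h_C1 dom_convex x_dom s_dom[OF x_dom]])
    have "gap_summand g h (x k) (s (x k)) i \<le> gap g h (x k)"
      by (simp add: gap_eq_Max(1)[OF g_proper s_min x_dom])
    then show "gap_summand g h (x k) (s (x k)) i \<le> - \<theta> k"
      by (simp add: gap_eq)
  qed (use hoelder_M x_dom nu_range clipped in auto)

  have \<delta>: "\<delta> k = (MIN i. merit g h i (x k) - merit g h i xs)" for k
    by (simp add: delta_eq merit_gap_eq_Min[OF g_proper xs_dom x_dom])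
  have \<delta>_le: "\<delta> k \<le> merit g h i (x k) - merit g h i xs" for i k
    by (simp add: \<delta>)
  have \<delta>_attained: "\<exists>i. \<delta> k = merit g h i (x k) - merit g h i xs" for k
  proof -
    have "\<delta> k \<in> range (\<lambda>i. merit g h i (x k) - merit g h i xs)"
      unfolding \<delta> by (rule Min_in) auto
    then show ?thesis by blast
  qed

  interpret cond_grad_recursion \<delta> \<theta> A \<alpha> c
  proof
    \<comment> \<open>The distinct points \<open>x 0\<close> and \<open>s (x 0)\<close> both lie in
      \<open>domG g\<close>.\<close>
    have "0 < D"
      using dist_le_D[OF x_dom[of 0]] moves[OF x_dom[of 0]]
      by (metis less_le_trans right_minus_eq zero_less_norm_iff)
    then show "0 < A"
      using M_pos by (simp add: A_eq)
    show "0 < \<alpha>" "0 < c" "c < 1"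
      using nu_range by (simp_all add: alpha_eq c_eq)
    fix k
    show "0 < \<theta> k" by (rule \<theta>_pos)
    obtain i where i: "\<delta> k = merit g h i (x k) - merit g h i xs"
      using \<delta>_attained by blast
    show "0 \<le> \<delta> k"
      using xs_le[of i k] i
      by (simp add: objective_eq_merit[OF g_proper x_dom] objective_eq_merit[OF g_proper xs_dom])
    show "\<delta> k \<le> \<theta> k"
    proof -
      \<comment> \<open>The gradient inequality bounds the summand by the difference of the
        objectives at \<open>xs\<close> and \<open>x k\<close>.\<close>
      have "gap_summand g h (x k) xs i \<le> - \<delta> k" for i
        using \<delta>_le[of k i] convex_above_gradient[OF h_C1 h_convex, of i "x k" xs]
        by (simp add: gap_summand_def merit_def)
      then have "(MAX i. gap_summand g h (x k) xs i) \<le> - \<delta> k"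
        by simp
      then show ?thesis
        using gap_eq_Max(2)[OF g_proper s_min x_dom xs_dom, of k] unfolding gap_eq by linarith
    qed
    have "\<theta> k * min 1 (\<theta> k powr \<alpha> / A) \<le> t k * \<theta> k"
      using clipped(4)[OF x_dom] \<theta>_pos[of k] by (simp add: mult.commute)
    then have "c * (\<theta> k * min 1 (\<theta> k powr \<alpha> / A)) \<le> c * (t k * \<theta> k)"
      using \<open>0 < c\<close> by (intro mult_left_mono) auto
    \<comment> \<open>The index \<open>i\<close> attains the minimum at \<open>x k\<close>; at the
      next iterate the same index still bounds the minimum from above.\<close>
    then show "\<delta> (Suc k) \<le> \<delta> k - c * (\<theta> k * min 1 (\<theta> k powr \<alpha> / A))"
      using \<delta>_le[of "Suc k" i] descent[of i k] i by simp
  qed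

  have burn_in: "\<delta> k0 powr \<alpha> \<le> A"
    by (rule \<delta>_burn_in) (simp only: k0_eq real_nat_ceiling_ge)
  have \<Gamma>: "\<Gamma> k = (1 / rate k0 k) powr (1 / \<alpha>)" for k
    by (simp add: Gamma_eq rate_def)
  show ?thesis
    using \<delta>_le_rate[OF burn_in] min_\<theta>_le_rate[OF burn_in] by (simp add: \<Gamma> \<theta>_def)
qed

end
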